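(* Let $C=(C_n)_{n\ge0}$ be the discrete coagulation process with merger distribution $\hat\pi$, and let $\nu_n(j)=\mathbb{P}\{C_n(i)=j\}$ (independent of $i\in\mathbb{N}$) be its cluster-size distribution at step $n$. If $\hat\pi$ is critical, i.e. $\sum_{k\ge0}k\hat\pi(k)=1$, then for all $n\ge 0$ and all integers $j>0$, $$\nu_{n+1}(j)-\nu_n(j)=\sum_{k\ge2}\hat R_k(\rho_n)\,\hat I_k(\nu_n,j),$$ where $$\rho_n=\mathbb{P}\{C_n(1)>0\}=\sum_{j>0}\nu_n(j),\qquad \hat R_k(\rho_n)=\sum_{l\ge k}\hat\pi(l)\binom{l}{k}\rho_n^k(1-\rho_n)^{l-k},$$ $$\hat I_k(\nu_n,j)=\sum_{i_1,\dots,i_k>0}\Big[\delta^j\Big(\sum_{l=1}^k i_l\Big)-\sum_{l=1}^k\delta^j(i_l)\Big]\frac{\nu_n(i_1)}{\rho_n}\cdots\frac{\nu_n(i_k)}{\rho_n}.$$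
   Context: $\mathbb{N}=\{1,2,\dots\}$, $\mathbb{N}_0=\mathbb{N}\cup\{0\}$. $\delta^j(k)=1$ if $k=j$ and $0$ otherwise. Coagulation process: let $\hat\pi$ be a probability measure on $\mathbb{N}_0$ (the merger distribution). For each $n\in\mathbb{N}_0$, $C_n$ is a random function from $\mathbb{N}$ to $\mathbb{N}_0$. Initially $C_0(j)=1$ for all $j\in\mathbb{N}$. Given $C_n$, choose a random sequence $(M_{k,n})_{k\in\mathbb{N}_0}$ independent of $C_m$, $0\le m\le n$, with $M_{0,n}=0$ and with increments $M_{k+1,n}-M_{k,n}\in\mathbb{N}_0$ that are independent and identically distributed with law $\hat\pi$, and set $$C_{n+1}(j)=\sum_{i=1+M_{j-1,n}}^{M_{j,n}}C_n(i),$$ the sum being $0$ if $M_{j,n}=M_{j-1,n}$. For each $n$, the variables $C_n(i)$, $i\in\mathbb{N}$, are independent and identically distributed. *)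

theory Defs
  imports "HOL-Probability.Probability"
begin

text \<open>
  The merger distribution is \<open>p\<close>; the sample space is \<open>P\<close>. \<open>C n j \<omega>\<close> is the size of the
  \<open>j\<close>-th cluster after \<open>n\<close> steps and \<open>M n k \<omega>\<close> is the \<open>k\<close>-th partial sum \<open>M\<^sub>k\<^sub>,\<^sub>n\<close>. Clusters are
  indexed by \<open>j \<ge> 1\<close>; the value \<open>C n 0\<close> is irrelevant and unconstrained.
  In \<open>indep_past\<close> the whole sequence \<open>(M n k)\<^sub>k\<close> is independent of the whole family
  \<open>(C m j)\<close> with \<open>m \<le> n\<close>, \<open>j \<ge> 1\<close>, taken jointly; \<open>indep_var\<close> also states that both
  are measurable. Since \<open>indep_var\<close> needs both random elements to have the same type, the sequence
  is indexed by pairs too, with first component fixed to \<open>n\<close>.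
\<close>

locale discrete_coagulation = prob_space P
  for P :: "'w measure" +
  fixes p :: "nat pmf"
    and C :: "nat \<Rightarrow> nat \<Rightarrow> 'w \<Rightarrow> nat"
    and M :: "nat \<Rightarrow> nat \<Rightarrow> 'w \<Rightarrow> nat"
  assumes C_init: "\<And>j \<omega>. j \<ge> 1 \<Longrightarrow> \<omega> \<in> space P \<Longrightarrow> C 0 j \<omega> = 1"
    and indep_past:
      "\<And>n. indep_var
         (Pi\<^sub>M ({n} \<times> UNIV) (\<lambda>_. count_space UNIV))
           (\<lambda>\<omega>. \<lambda>(m, k)\<in>{n} \<times> UNIV. M m k \<omega>)
         (Pi\<^sub>M ({..n} \<times> {1..}) (\<lambda>_. count_space UNIV))
           (\<lambda>\<omega>. \<lambda>(m, j)\<in>{..n} \<times> {1..}. C m j \<omega>)"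
    and M_0: "\<And>n \<omega>. \<omega> \<in> space P \<Longrightarrow> M n 0 \<omega> = 0"
    and M_mono: "\<And>n k \<omega>. \<omega> \<in> space P \<Longrightarrow> M n k \<omega> \<le> M n (Suc k) \<omega>"
    and incr_indep:
      "\<And>n. indep_vars (\<lambda>_. count_space UNIV) (\<lambda>k \<omega>. M n (Suc k) \<omega> - M n k \<omega>) UNIV"
    and incr_law:
      "\<And>n k. distr P (count_space UNIV) (\<lambda>\<omega>. M n (Suc k) \<omega> - M n k \<omega>) = measure_pmf p"
    and C_step:
      "\<And>n j \<omega>. j \<ge> 1 \<Longrightarrow> \<omega> \<in> space P \<Longrightarrow>
         C (Suc n) j \<omega> = (\<Sum>i = 1 + M n (j - 1) \<omega>..M n j \<omega>. C n i \<omega>)"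

definition critical :: "nat pmf \<Rightarrow> bool" where
  "critical p \<longleftrightarrow> ((\<lambda>k. real k * pmf p k) has_sum 1) UNIV"

text \<open>The law of \<open>C n i\<close> does not depend on \<open>i \<ge> 1\<close>, so the first cluster is used.\<close>

definition cluster_dist :: "'w measure \<Rightarrow> (nat \<Rightarrow> nat \<Rightarrow> 'w \<Rightarrow> nat) \<Rightarrow> nat \<Rightarrow> nat \<Rightarrow> real" where
  "cluster_dist P C n j = measure P {\<omega> \<in> space P. C n 1 \<omega> = j}"

definition nonempty_prob :: "'w measure \<Rightarrow> (nat \<Rightarrow> nat \<Rightarrow> 'w \<Rightarrow> nat) \<Rightarrow> nat \<Rightarrow> real" where
  "nonempty_prob P C n = measure P {\<omega> \<in> space P. C n 1 \<omega> > 0}"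

definition delta :: "nat \<Rightarrow> nat \<Rightarrow> real" where
  "delta j k = (if k = j then 1 else 0)"

definition rate_term :: "nat pmf \<Rightarrow> nat \<Rightarrow> real \<Rightarrow> nat \<Rightarrow> real" where
  "rate_term p k r l = pmf p l * real (l choose k) * r ^ k * (1 - r) ^ (l - k)"

definition rate :: "nat pmf \<Rightarrow> nat \<Rightarrow> real \<Rightarrow> real" where
  "rate p k r = (\<Sum>\<^sub>\<infinity>l\<in>{k..}. rate_term p k r l)"

text \<open>The tuple \<open>(i\<^sub>1, \<dots>, i\<^sub>k)\<close> is a function on \<open>{1..k}\<close>; \<open>r\<close> is the
  total mass of \<open>\<nu>\<close> on the positive integers.\<close>

definition coag_term :: "nat \<Rightarrow> real \<Rightarrow> (nat \<Rightarrow> real) \<Rightarrow> nat \<Rightarrow> (nat \<Rightarrow> nat) \<Rightarrow> real" where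
  "coag_term k r \<nu> j i =
     (delta j (\<Sum>l = 1..k. i l) - (\<Sum>l = 1..k. delta j (i l))) * (\<Prod>l = 1..k. \<nu> (i l) / r)"

definition coag :: "nat \<Rightarrow> real \<Rightarrow> (nat \<Rightarrow> real) \<Rightarrow> nat \<Rightarrow> real" where
  "coag k r \<nu> j = (\<Sum>\<^sub>\<infinity>i\<in>{1..k} \<rightarrow>\<^sub>E {0<..}. coag_term k r \<nu> j i)"

end

theory Submission
  imports Defs
begin

text \<open>
  Write \<open>q\<^sub>n\<close> for the law of a cluster at step \<open>n\<close>. The first point is that the clusters at step
  \<open>n\<close> are independent with this common law. The first \<open>J\<close> clusters at step \<open>n + 1\<close> are the
  consecutive block sums of the clusters at step \<open>n\<close>, the block lengths being \<open>J\<close> independent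
  draws from the merger distribution \<open>p\<close> that are independent of the clusters. Blocks do not
  overlap, so block sums of an i.i.d. sequence are again i.i.d., and each is a sum of \<open>m\<close>
  independent copies of \<open>q\<^sub>n\<close> with \<open>m\<close> drawn from \<open>p\<close>
  (\<open>block_sums_replicate_pmf\<close>, \<open>distr_clusters\<close>).

  The second point is that empty clusters contribute nothing to a sum. A draw from \<open>q\<^sub>n\<close> is an
  independent coin of bias \<open>\<rho>\<^sub>n\<close> that decides whether the cluster is nonempty, followed in
  that case by a draw from the conditioned law \<open>q' = q\<^sub>n(\<cdot> | > 0)\<close>. Hence the sum of \<open>m\<close> copies of
  \<open>q\<^sub>n\<close> is a sum of \<open>k\<close> copies of \<open>q'\<close> with \<open>k\<close> binomial (\<open>iid_sum_thinning\<close>). Mixing over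
  \<open>m\<close>, the number \<open>k\<close> of nonempty clusters merging into one cluster has the law
  \<open>k \<mapsto> R\<^sub>k(\<rho>\<^sub>n)\<close>, and, with \<open>q'\<^sup>*\<^sup>k\<close> for the law of the sum,
  \<open>q\<^sub>n\<^sub>+\<^sub>1(j) = \<Sum>\<^sub>k R\<^sub>k q'\<^sup>*\<^sup>k(j)\<close>. Criticality gives this law the mean \<open>1 \<cdot> \<rho>\<^sub>n\<close>, so for \<open>j > 0\<close>
  the loss term can be put under the same sum: \<open>q\<^sub>n(j) = \<rho>\<^sub>n q'(j) = \<Sum>\<^sub>k R\<^sub>k k q'(j)\<close>. The
  difference has the summands \<open>R\<^sub>k (q'\<^sup>*\<^sup>k(j) - k q'(j))\<close>, which vanish for \<open>k = 0\<close> and \<open>k = 1\<close>.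
  The second factor is \<open>I\<^sub>k\<close>: it is the expectation of \<open>\<delta>\<^sup>j(\<Sum>\<^sub>l i\<^sub>l) - \<Sum>\<^sub>l \<delta>\<^sup>j(i\<^sub>l)\<close> over \<open>k\<close> independent
  draws \<open>i\<^sub>1, \<dots>, i\<^sub>k\<close> from \<open>q'\<close> (\<open>has_sum_coag_term\<close>, \<open>coagulation_rate_equation\<close>).
\<close>

section \<open>Sums of independent copies of a discrete law\<close>

definition iid_sum :: "nat \<Rightarrow> nat pmf \<Rightarrow> nat pmf" where
  "iid_sum m q = map_pmf sum_list (replicate_pmf m q)"

text \<open>
  Every infinite sum in the rate equation is obtained as an expectation: this lemma supplies both
  its convergence and its value.
\<close>
lemma has_sum_expectation_pmf:
  fixes g :: "'a \<Rightarrow> real"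
  assumes "integrable (measure_pmf q) g"
    and "\<And>x. x \<in> set_pmf q \<Longrightarrow> g x \<noteq> 0 \<Longrightarrow> x \<in> A"
  shows "((\<lambda>x. pmf q x * g x) has_sum measure_pmf.expectation q g) A"
proof -
  have "integrable (count_space UNIV) (\<lambda>x. pmf q x * g x)"
    using assms(1) unfolding measure_pmf_eq_density by (subst (asm) integrable_density) auto
  then have "Infinite_Set_Sum.abs_summable_on (\<lambda>x. pmf q x * g x) UNIV"
    by (simp add: Infinite_Set_Sum.abs_summable_on_def)
  then have abs: "Infinite_Sum.abs_summable_on (\<lambda>x. pmf q x * g x) UNIV"
    by (rule iffD2[OF abs_summable_equivalent])
  then have "measure_pmf.expectation q g = (\<Sum>\<^sub>\<infinity>x. pmf q x * g x)"
    unfolding pmf_expectation_eq_infsetsum by (rule infsetsum_infsum[OF iffD1[OF abs_summable_equivalent]])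
  then have "((\<lambda>x. pmf q x * g x) has_sum measure_pmf.expectation q g) UNIV"
    using has_sum_infsum[OF abs_summable_summable[OF abs]] by simp
  also have "?this \<longleftrightarrow> ?thesis"
    using assms(2) by (intro has_sum_cong_neutral) (auto simp: set_pmf_iff)
  finally show ?thesis .
qed

lemma pmf_replicate_pmf:
  "pmf (replicate_pmf n q) xs = (if length xs = n then prod_list (map (pmf q) xs) else 0)"
proof (induction n arbitrary: xs)
  case 0
  show ?case by (auto simp: indicator_def)
next
  case (Suc n)
  have eq: "replicate_pmf (Suc n) q = map_pmf (\<lambda>(x, xs). x # xs) (pair_pmf q (replicate_pmf n q))"
    by (simp add: pair_pmf_def map_bind_pmf map_pmf_def bind_assoc_pmf bind_return_pmf)
  show ?case
  proof (cases xs)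
    case Nil
    then show ?thesis by (simp add: pmf_eq_0_set_pmf set_replicate_pmf)
  next
    case (Cons y ys)
    have "pmf (replicate_pmf (Suc n) q) xs
        = pmf (map_pmf (\<lambda>(x, xs). x # xs) (pair_pmf q (replicate_pmf n q))) ((\<lambda>(x, xs). x # xs) (y, ys))"
      by (simp only: eq Cons prod.case)
    also have "\<dots> = pmf q y * pmf (replicate_pmf n q) ys"
      by (subst pmf_map_inj') (auto simp: inj_def pmf_pair)
    finally show ?thesis by (simp add: Suc.IH Cons)
  qed
qed

lemma map_nth_replicate_pmf: "i < n \<Longrightarrow> map_pmf (\<lambda>xs. xs ! i) (replicate_pmf n q) = q"
proof (induction n arbitrary: i)
  case (Suc n)
  then show ?case
    by (cases i) (simp_all add: map_bind_pmf map_pmf_def[symmetric] bind_return_pmf'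
        bind_pmf_const map_pmf_comp map_pmf_const)
qed simp

lemma replicate_pmf_return: "replicate_pmf n (return_pmf x) = return_pmf (replicate n x)"
  by (induction n) (simp_all add: bind_return_pmf)

lemma iid_sum_0: "iid_sum 0 q = return_pmf 0"
  by (simp add: iid_sum_def)

lemma iid_sum_Suc:
  "iid_sum (Suc m) q = do {x \<leftarrow> q; s \<leftarrow> iid_sum m q; return_pmf (x + s)}"
  by (simp add: iid_sum_def map_pmf_def bind_assoc_pmf bind_return_pmf)

lemma iid_sum_1: "iid_sum (Suc 0) q = q"
  by (simp add: iid_sum_Suc iid_sum_0 bind_return_pmf bind_return_pmf')

text \<open>
  The process is described by lists, the coagulation operator by functions on \<open>{1..k}\<close>; this is
  the passage between the two.
\<close>
lemma map_sum_Pi_pmf: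
  assumes "finite A"
  shows "map_pmf (\<lambda>f. \<Sum>x\<in>A. f x) (Pi_pmf A d (\<lambda>_. q)) = iid_sum (card A) q"
  using assms
proof (induction A rule: finite_induct)
  case (insert x A)
  have "map_pmf (\<lambda>f. \<Sum>x\<in>insert x A. f x) (Pi_pmf (insert x A) d (\<lambda>_. q))
      = do {y \<leftarrow> q; f \<leftarrow> Pi_pmf A d (\<lambda>_. q); return_pmf (y + (\<Sum>z\<in>A. f z))}"
  proof -
    have "(\<Sum>z\<in>A. (f(x := y)) z) = (\<Sum>z\<in>A. f z)" for f and y :: nat
      using insert.hyps by (intro sum.cong) auto
    then show ?thesis
      using insert.hyps
      by (simp add: Pi_pmf_insert' map_bind_pmf map_pmf_def bind_assoc_pmf bind_return_pmf fun_upd_same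
          del: fun_upd_apply)
  qed
  also have "\<dots> = do {y \<leftarrow> q; s \<leftarrow> map_pmf (\<lambda>f. \<Sum>x\<in>A. f x) (Pi_pmf A d (\<lambda>_. q)); return_pmf (y + s)}"
    by (simp add: map_pmf_def bind_assoc_pmf bind_return_pmf)
  finally show ?case
    using insert by (simp add: iid_sum_Suc)
qed (simp add: iid_sum_0)

section \<open>Block sums of independent copies are independent copies\<close>

text \<open>
  One coagulation step: \<open>ds\<close> lists the merger sizes and \<open>xs\<close> the cluster sizes. When \<open>xs\<close> has
  length \<open>sum_list ds\<close>, as in every use below, the blocks exhaust it.
\<close>
fun block_sums :: "nat list \<Rightarrow> nat list \<Rightarrow> nat list" where
  "block_sums [] xs = []"
| "block_sums (d # ds) xs = sum_list (take d xs) # block_sums ds (drop d xs)"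

lemma block_sums_snoc:
  "length xs = sum_list ds \<Longrightarrow>
    block_sums (ds @ [d]) (xs @ ys) = block_sums ds xs @ [sum_list (take d ys)]"
  by (induction ds arbitrary: xs) auto

text \<open>
  The first block is independent of the remaining entries, and its sum depends only on the first
  block length, so the randomness of the first block sum and of the others separates.
\<close>
lemma block_sums_replicate_pmf:
  "bind_pmf (replicate_pmf n p) (\<lambda>ds. map_pmf (block_sums ds) (replicate_pmf (sum_list ds) q))
    = replicate_pmf n (bind_pmf p (\<lambda>m. iid_sum m q))"
proof (induction n)
  case (Suc n)
  let ?blocks = "bind_pmf (replicate_pmf n p) (\<lambda>ds. map_pmf (block_sums ds) (replicate_pmf (sum_list ds) q))"
  have blocks_Cons: "map_pmf (block_sums (m # ds)) (replicate_pmf (m + sum_list ds) q)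
      = do {xs \<leftarrow> replicate_pmf m q; ys \<leftarrow> replicate_pmf (sum_list ds) q;
            return_pmf (sum_list xs # block_sums ds ys)}" for m ds
    unfolding replicate_pmf_distrib map_bind_pmf
    by (intro bind_pmf_cong refl) (auto simp: set_replicate_pmf)
  have "bind_pmf (replicate_pmf (Suc n) p) (\<lambda>ds. map_pmf (block_sums ds) (replicate_pmf (sum_list ds) q))
    = do {m \<leftarrow> p; ds \<leftarrow> replicate_pmf n p; xs \<leftarrow> replicate_pmf m q;
          ys \<leftarrow> replicate_pmf (sum_list ds) q; return_pmf (sum_list xs # block_sums ds ys)}"
    by (simp add: bind_assoc_pmf bind_return_pmf blocks_Cons del: block_sums.simps)
  \<comment> \<open>Drawing the first block before the other block lengths makes the two groups of draws
      contiguous.\<close>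
  also have "\<dots> = do {m \<leftarrow> p; xs \<leftarrow> replicate_pmf m q; ds \<leftarrow> replicate_pmf n p;
          ys \<leftarrow> replicate_pmf (sum_list ds) q; return_pmf (sum_list xs # block_sums ds ys)}"
    by (subst bind_commute_pmf) (rule refl)
  also have "\<dots> = do {m \<leftarrow> p; s \<leftarrow> iid_sum m q; zs \<leftarrow> ?blocks; return_pmf (s # zs)}"
    by (simp add: iid_sum_def map_pmf_def bind_assoc_pmf bind_return_pmf)
  finally show ?case
    by (simp add: Suc.IH bind_assoc_pmf)
qed (simp add: bind_return_pmf)

section \<open>Thinning out the empty clusters\<close>

lemma pmf_eq_bernoulli_mixture:
  fixes q :: "nat pmf"
  defines "r \<equiv> measure_pmf.prob q {0<..}"
  assumes "r > 0"
  shows "q = bind_pmf (bernoulli_pmf r) (\<lambda>b. if b then cond_pmf q {0<..} else return_pmf 0)"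
proof (rule pmf_eqI)
  fix i
  have ne: "set_pmf q \<inter> {0<..} \<noteq> {}"
    using assms by (metis less_irrefl measure_Int_set_pmf measure_empty inf_commute)
  have r1: "r \<le> 1" by (simp add: r_def)
  have "{0} = UNIV - {0::nat<..}" by auto
  then have q0: "pmf q 0 = 1 - r"
    by (metis measure_pmf.prob_compl measure_pmf_single r_def sets_measure_pmf space_measure_pmf UNIV_I)
  show "pmf q i = pmf (bind_pmf (bernoulli_pmf r) (\<lambda>b. if b then cond_pmf q {0<..} else return_pmf 0)) i"
    using \<open>r > 0\<close> r1 q0 by (cases "i = 0") (auto simp: pmf_bind pmf_cond[OF ne] r_def[symmetric])
qed

text \<open>
  A summand whose coin shows tails contributes \<open>0\<close>, so the law of the sum depends on the coins
  only through the number of heads, which is binomial.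
\<close>
lemma iid_sum_thinning:
  assumes q: "q = bind_pmf (bernoulli_pmf r) (\<lambda>b. if b then q' else return_pmf 0)"
    and r: "r \<in> {0..1}"
  shows "iid_sum m q = bind_pmf (binomial_pmf m r) (\<lambda>k. iid_sum k q')"
proof (induction m)
  case 0
  show ?case using r by (simp add: binomial_pmf_0 iid_sum_0 bind_return_pmf)
next
  case (Suc m)
  have "iid_sum (Suc m) q = do {b \<leftarrow> bernoulli_pmf r; x \<leftarrow> (if b then q' else return_pmf 0);
      k \<leftarrow> binomial_pmf m r; s \<leftarrow> iid_sum k q'; return_pmf (x + s)}"
    unfolding iid_sum_Suc Suc.IH by (subst q) (simp add: bind_assoc_pmf)
  also have "\<dots> = do {b \<leftarrow> bernoulli_pmf r; k \<leftarrow> binomial_pmf m r;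
      x \<leftarrow> (if b then q' else return_pmf 0); s \<leftarrow> iid_sum k q'; return_pmf (x + s)}"
    by (subst bind_commute_pmf) (rule refl)
  also have "\<dots> = do {b \<leftarrow> bernoulli_pmf r; k \<leftarrow> binomial_pmf m r;
      iid_sum ((if b then 1 else 0) + k) q'}"
    by (intro bind_pmf_cong refl) (simp add: iid_sum_Suc bind_return_pmf bind_return_pmf')
  finally show ?case
    using r by (simp add: binomial_pmf_Suc bind_assoc_pmf bind_return_pmf)
qed

lemma nn_integral_binomial_pmf:
  assumes "r \<in> {0..1}"
  shows "(\<integral>\<^sup>+k. ennreal (real k) \<partial>binomial_pmf n r) = ennreal (real n * r)"
proof (induction n)
  case 0
  show ?case using assms by (simp add: binomial_pmf_0)
next
  case (Suc n)
  have "(\<integral>\<^sup>+k. ennreal (real (b + k)) \<partial>binomial_pmf n r) = ennreal (real b + real n * r)" for b :: nat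
    using assms Suc.IH by (simp add: nn_integral_add ennreal_plus)
  from this[of 0] this[of 1] show ?case
    using assms
    by (simp add: binomial_pmf_Suc nn_integral_bernoulli_pmf flip: ennreal_mult ennreal_plus)
       (simp add: algebra_simps)
qed

lemma nn_integral_critical:
  assumes "critical p"
  shows "(\<integral>\<^sup>+k. ennreal (real k) \<partial>measure_pmf p) = 1"
proof -
  have "(\<lambda>k. real k * pmf p k) sums 1"
    using assms unfolding critical_def by (rule has_sum_imp_sums)
  then have "(\<Sum>k. ennreal (real k * pmf p k)) = ennreal 1"
    by (intro suminf_ennreal_eq) auto
  then show ?thesis
    by (simp add: nn_integral_measure_pmf nn_integral_count_space_nat ennreal_mult'' mult.commute)
qed

lemma rate_term_eq:
  assumes "r \<in> {0..1}"
  shows "rate_term p k r = (\<lambda>l. pmf p l * pmf (binomial_pmf l r) k)"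
  using assms by (auto simp: rate_term_def mult_ac)

text \<open>
  If each cluster is nonempty with probability \<open>r\<close>, the rates are the law of the number of nonempty
  clusters in a merger. The sum may start at \<open>k\<close> because fewer than \<open>k\<close> clusters cannot contain \<open>k\<close> nonempty ones.
\<close>
lemma has_sum_rate_term:
  assumes "r \<in> {0..1}"
  shows "(rate_term p k r has_sum pmf (bind_pmf p (\<lambda>l. binomial_pmf l r)) k) {k..}"
  unfolding rate_term_eq[OF assms] pmf_bind
proof (rule has_sum_expectation_pmf)
  show "integrable (measure_pmf p) (\<lambda>l. pmf (binomial_pmf l r) k)"
    by (rule measure_pmf.integrable_const_bound[where B = 1]) (auto simp: pmf_le_1)
  show "l \<in> {k..}" if "pmf (binomial_pmf l r) k \<noteq> 0" for l
    using that assms by (cases "l < k") auto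
qed

text \<open>
  Criticality makes the mean number of nonempty clusters in a merger equal to \<open>r\<close>: keeping
  each of \<open>l\<close> clusters with probability \<open>r\<close> leaves \<open>l r\<close> on average, and \<open>l\<close> averages to \<open>1\<close>.
\<close>
lemma nn_integral_thinned_critical:
  assumes "critical p" "r \<in> {0..1}"
  shows "(\<integral>\<^sup>+k. ennreal (real k) \<partial>bind_pmf p (\<lambda>l. binomial_pmf l r)) = ennreal r"
proof -
  have "(\<integral>\<^sup>+k. ennreal (real k) \<partial>bind_pmf p (\<lambda>l. binomial_pmf l r))
      = (\<integral>\<^sup>+l. ennreal (real l) * ennreal r \<partial>measure_pmf p)"
    using assms by (simp add: nn_integral_binomial_pmf ennreal_mult)
  also have "\<dots> = ennreal r"
    using assms by (simp add: nn_integral_multc nn_integral_critical)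
  finally show ?thesis .
qed

section \<open>The rate equation for one coagulation step\<close>

text \<open>
  The product of the weights is the probability of the tuple under \<open>k\<close> independent draws from \<open>q'\<close>,
  so the sum is an expectation. Its gain part is the probability that the draws sum to \<open>j\<close>; its
  loss part is the expected number of draws equal to \<open>j\<close>.
\<close>
lemma has_sum_coag_term:
  assumes \<nu>: "\<And>i. i > 0 \<Longrightarrow> \<nu> i / r = pmf q' i" and pos: "set_pmf q' \<subseteq> {0<..}"
  shows "(coag_term k r \<nu> j has_sum (pmf (iid_sum k q') j - real k * pmf q' j)) ({1..k} \<rightarrow>\<^sub>E {0<..})"
proof -
  \<comment> \<open>The default \<open>undefined\<close> is the value that extensional functions take outside their domain.\<close>
  let ?Q = "Pi_pmf {1..k} undefined (\<lambda>_. q')"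
  let ?g = "\<lambda>i. delta j (\<Sum>l = 1..k. i l) - (\<Sum>l = 1..k. delta j (i l))"
  have int: "integrable (measure_pmf Q) (\<lambda>i. delta j (f i))" for Q :: "'b pmf" and f
    by (rule measure_pmf.integrable_const_bound[where B = 1]) (auto simp: delta_def)
  have E: "measure_pmf.expectation Q (\<lambda>i. delta j (f i)) = pmf (map_pmf f Q) j"
    for Q :: "'b pmf" and f
  proof -
    have "(\<lambda>i. delta j (f i)) = indicator (f -` {j})"
      by (auto simp: delta_def fun_eq_iff)
    then show ?thesis by (simp add: pmf_map)
  qed
  have comp: "map_pmf (\<lambda>i. i l) ?Q = q'" if "l \<in> {1..k}" for l
    using that by (simp add: Pi_pmf_component)
  have "measure_pmf.expectation ?Q ?g = pmf (iid_sum k q') j - real k * pmf q' j"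
    using map_sum_Pi_pmf[of "{1..k}" undefined q'] comp
    by (simp add: Bochner_Integration.integral_diff Bochner_Integration.integral_sum int E)
  moreover have "((\<lambda>i. pmf ?Q i * ?g i) has_sum measure_pmf.expectation ?Q ?g) ({1..k} \<rightarrow>\<^sub>E {0<..})"
  proof (rule has_sum_expectation_pmf)
    show "integrable (measure_pmf ?Q) ?g"
      by (intro Bochner_Integration.integrable_diff Bochner_Integration.integrable_sum int)
    show "i \<in> {1..k} \<rightarrow>\<^sub>E {0<..}" if "i \<in> set_pmf ?Q" for i
      using that pos by (fastforce simp: set_Pi_pmf PiE_dflt_def)
  qed
  moreover have "coag_term k r \<nu> j i = pmf ?Q i * ?g i" if i: "i \<in> {1..k} \<rightarrow>\<^sub>E {0<..}" for i
  proof -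
    have "pmf ?Q i = (\<Prod>l = 1..k. pmf q' (i l))"
      using i by (subst pmf_Pi') auto
    also have "\<dots> = (\<Prod>l = 1..k. \<nu> (i l) / r)"
      using i by (intro prod.cong refl) (simp add: \<nu> PiE_iff)
    finally show ?thesis by (simp add: coag_term_def)
  qed
  ultimately show ?thesis
    using has_sum_cong[of "{1..k} \<rightarrow>\<^sub>E {0<..}" "coag_term k r \<nu> j" "\<lambda>i. pmf ?Q i * ?g i"]
    by (simp only:)
qed

text \<open>
  The rates have mean \<open>r\<close>, so the mass \<open>pmf q j\<close> can be distributed over the merger sizes as the
  loss terms.
\<close>
lemma coagulation_rate_equation:
  fixes p q :: "nat pmf"
  defines "r \<equiv> measure_pmf.prob q {0<..}"
  assumes crit: "critical p" and r: "r > 0" and j: "j > 0"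
  shows "coag_term k r (pmf q) j summable_on ({1..k} \<rightarrow>\<^sub>E {0<..})"
    and "((\<lambda>k. rate p k r * coag k r (pmf q) j)
           has_sum (pmf (bind_pmf p (\<lambda>m. iid_sum m q)) j - pmf q j)) {2..}"
proof -
  define q' where "q' = cond_pmf q {0<..}"
  define K where "K = bind_pmf p (\<lambda>l. binomial_pmf l r)"
  have r01: "r \<in> {0..1}" using r by (simp add: r_def)
  have ne: "set_pmf q \<inter> {0<..} \<noteq> {}"
    using r unfolding r_def by (metis less_irrefl measure_Int_set_pmf measure_empty inf_commute)
  have q': "pmf q i / r = pmf q' i" if "i > 0" for i
    using that by (simp add: q'_def pmf_cond[OF ne] r_def)
  have coag: "(coag_term k r (pmf q) j has_sum (pmf (iid_sum k q') j - real k * pmf q' j))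
      ({1..k} \<rightarrow>\<^sub>E {0<..})" for k
    by (rule has_sum_coag_term) (auto simp: q' q'_def set_cond_pmf[OF ne])
  show "coag_term k r (pmf q) j summable_on ({1..k} \<rightarrow>\<^sub>E {0<..})"
    using coag by (rule has_sum_imp_summable)
  have "bind_pmf p (\<lambda>m. iid_sum m q) = bind_pmf K (\<lambda>k. iid_sum k q')"
    using iid_sum_thinning[OF pmf_eq_bernoulli_mixture[OF r[unfolded r_def]] r01[unfolded r_def]]
    by (simp add: K_def bind_assoc_pmf q'_def r_def)
  then have new: "pmf (bind_pmf p (\<lambda>m. iid_sum m q)) j
      = measure_pmf.expectation K (\<lambda>k. pmf (iid_sum k q') j)"
    by (simp add: pmf_bind)
  have nnK: "(\<integral>\<^sup>+k. ennreal (real k) \<partial>measure_pmf K) = ennreal r"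
    unfolding K_def by (rule nn_integral_thinned_critical[OF crit r01])
  have intK: "integrable (measure_pmf K) real"
    by (rule integrableI_nonneg) (auto simp: nnK)
  have EK: "measure_pmf.expectation K real = r"
    using r by (simp add: integral_eq_nn_integral nnK)
  have int: "integrable (measure_pmf K) (\<lambda>k. pmf (iid_sum k q') j)"
    by (rule measure_pmf.integrable_const_bound[where B = 1]) (auto simp: pmf_le_1)
  let ?g = "\<lambda>k. pmf (iid_sum k q') j - real k * pmf q' j"
  have "((\<lambda>k. pmf K k * ?g k) has_sum measure_pmf.expectation K ?g) {2..}"
  proof (rule has_sum_expectation_pmf)
    show "integrable (measure_pmf K) ?g"
      using int intK by simp
    show "k \<in> {2..}" if "?g k \<noteq> 0" for k
    proof (rule ccontr)
      \<comment> \<open>No nonempty cluster gives size \<open>0 \<noteq> j\<close>; a single one keeps its size, so gain equals loss.\<close>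
      assume "k \<notin> {2..}"
      then have "k = 0 \<or> k = Suc 0" by auto
      then show False using that j by (auto simp: iid_sum_0 iid_sum_1)
    qed
  qed
  also have "measure_pmf.expectation K ?g = pmf (bind_pmf p (\<lambda>m. iid_sum m q)) j - pmf q j"
    using int intK r q'[OF j] by (simp add: new EK field_simps)
  also have "(\<lambda>k. pmf K k * ?g k) = (\<lambda>k. rate p k r * coag k r (pmf q) j)"
    unfolding rate_def coag_def K_def
    by (simp add: infsumI[OF has_sum_rate_term[OF r01]] infsumI[OF coag] del: One_nat_def)
  finally show "((\<lambda>k. rate p k r * coag k r (pmf q) j)
      has_sum (pmf (bind_pmf p (\<lambda>m. iid_sum m q)) j - pmf q j)) {2..}" .
qed

text \<open>
  Nonempty clusters remain possible: mean merger size \<open>1\<close> forces some \<open>m > 0\<close> to have positive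
  probability, and merging \<open>m\<close> clusters of a possible size \<open>x > 0\<close> produces one of size \<open>m x > 0\<close>.
\<close>
lemma prob_pos_bind_iid_sum:
  fixes p q :: "nat pmf"
  assumes "critical p" "measure_pmf.prob q {0<..} > 0"
  shows "measure_pmf.prob (bind_pmf p (\<lambda>m. iid_sum m q)) {0<..} > 0"
proof -
  obtain x where x: "x \<in> set_pmf q" "x > 0"
    using assms(2) by (metis measure_pmf_zero_iff disjoint_iff greaterThan_iff less_irrefl)
  obtain m where m: "m \<in> set_pmf p" "m > 0"
  proof (rule ccontr)
    assume "\<not> thesis"
    with that have "AE k in measure_pmf p. ennreal (real k) = 0"
      by (auto simp: AE_measure_pmf_iff)
    then have "(\<integral>\<^sup>+k. ennreal (real k) \<partial>measure_pmf p) = 0"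
      by (subst nn_integral_0_iff_AE) auto
    then show False using nn_integral_critical[OF assms(1)] by simp
  qed
  have "replicate m x \<in> set_pmf (replicate_pmf m q)"
    using x by (auto simp: set_replicate_pmf)
  then have "sum_list (replicate m x) \<in> set_pmf (iid_sum m q)"
    unfolding iid_sum_def by (metis imageI set_map_pmf)
  then have "m * x \<in> set_pmf (iid_sum m q)"
    by (simp add: sum_list_replicate)
  then show ?thesis
    using m x by (intro measure_pmf_posI[where x = "m * x"]) auto
qed

section \<open>The clusters at each step are independent and identically distributed\<close>

text \<open>
  The form of conditioning needed for random block lengths: the list that is cut into blocks has a
  length that itself depends on the lengths drawn, so it is a family indexed by the values of \<open>D\<close>.
\<close>
lemma distr_mixture:
  fixes D :: "'w \<Rightarrow> 'd :: countable" and X :: "'d \<Rightarrow> 'w \<Rightarrow> 'x :: countable"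
  assumes D [measurable]: "D \<in> measurable P (count_space UNIV)"
    and X [measurable]: "\<And>d. X d \<in> measurable P (count_space UNIV)"
    and joint: "\<And>d x. emeasure P {\<omega> \<in> space P. D \<omega> = d \<and> X d \<omega> = x} = ennreal (pmf R d * pmf (S d) x)"
  shows "distr P (count_space UNIV) (\<lambda>\<omega>. X (D \<omega>) \<omega>) = measure_pmf (bind_pmf R S)"
proof (rule measure_eqI_countable[where A = UNIV])
  fix x
  have [measurable]: "(\<lambda>\<omega>. X (D \<omega>) \<omega>) \<in> measurable P (count_space UNIV)"
    by (rule measurable_compose_countable[OF X D])
  have "emeasure (distr P (count_space UNIV) (\<lambda>\<omega>. X (D \<omega>) \<omega>)) {x}
      = emeasure P (\<Union>d\<in>UNIV. {\<omega> \<in> space P. D \<omega> = d \<and> X d \<omega> = x})"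
    by (subst emeasure_distr) (auto intro!: arg_cong[where f = "emeasure P"])
  also have "\<dots> = (\<integral>\<^sup>+d. emeasure P {\<omega> \<in> space P. D \<omega> = d \<and> X d \<omega> = x} \<partial>count_space UNIV)"
    by (rule emeasure_UN_countable) (auto simp: disjoint_family_on_def)
  also have "\<dots> = ennreal (pmf (bind_pmf R S) x)"
    by (simp add: joint ennreal_pmf_bind nn_integral_measure_pmf ennreal_mult)
  finally show "emeasure (distr P (count_space UNIV) (\<lambda>\<omega>. X (D \<omega>) \<omega>)) {x}
      = emeasure (measure_pmf (bind_pmf R S)) {x}"
    by (simp add: emeasure_pmf_single)
qed auto

lemma measurable_map_countable:
  fixes f :: "'i \<Rightarrow> 'a \<Rightarrow> 'b :: countable"
  assumes "\<And>i. i \<in> set is \<Longrightarrow> f i \<in> measurable N (count_space UNIV)"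
  shows "(\<lambda>x. map (\<lambda>i. f i x) is) \<in> measurable N (count_space UNIV)"
  using assms
proof (induction "is")
  case (Cons i "is")
  have "(\<lambda>x. (\<lambda>b. b # map (\<lambda>i. f i x) is) (f i x)) \<in> measurable N (count_space UNIV)"
  proof (rule measurable_compose_countable[where f = "\<lambda>b x. b # map (\<lambda>i. f i x) is" and g = "f i"])
    show "(\<lambda>x. b # map (\<lambda>i. f i x) is) \<in> measurable N (count_space UNIV)" for b
      using Cons by (intro measurable_compose[of _ N "count_space UNIV" "\<lambda>bs. b # bs"]) auto
  qed (use Cons in auto)
  then show ?case by simp
qed simp

context discrete_coagulation
begin

definition clusters :: "nat \<Rightarrow> nat \<Rightarrow> 'w \<Rightarrow> nat list" where
  "clusters n N \<omega> = map (\<lambda>i. C n i \<omega>) [1..<Suc N]"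

definition mergers :: "nat \<Rightarrow> nat \<Rightarrow> 'w \<Rightarrow> nat list" where
  "mergers n J \<omega> = map (\<lambda>k. M n (Suc k) \<omega> - M n k \<omega>) [0..<J]"

lemma length_clusters: "length (clusters n N \<omega>) = N"
  by (simp add: clusters_def)

lemma sum_list_mergers: "\<omega> \<in> space P \<Longrightarrow> sum_list (mergers n J \<omega>) = M n J \<omega>"
  by (induction J) (simp_all add: mergers_def M_0 M_mono)

lemma clusters_Suc:
  assumes "\<omega> \<in> space P"
  shows "clusters (Suc n) J \<omega>
       = block_sums (mergers n J \<omega>) (clusters n (sum_list (mergers n J \<omega>)) \<omega>)"
  unfolding sum_list_mergers[OF assms]
proof (induction J)
  case 0
  show ?case by (simp add: clusters_def mergers_def)
next
  case (Suc J)
  let ?new = "map (\<lambda>i. C n i \<omega>) [Suc (M n J \<omega>)..<Suc (M n (Suc J) \<omega>)]"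
  have le: "M n J \<omega> \<le> M n (Suc J) \<omega>" using assms by (rule M_mono)
  have "[1..<Suc (M n (Suc J) \<omega>)] = [1..<Suc (M n J \<omega>)] @ [Suc (M n J \<omega>)..<Suc (M n (Suc J) \<omega>)]"
    using le upt_add_eq_append[of 1 "Suc (M n J \<omega>)" "M n (Suc J) \<omega> - M n J \<omega>"] by simp
  then have old: "clusters n (M n (Suc J) \<omega>) \<omega> = clusters n (M n J \<omega>) \<omega> @ ?new"
    by (simp add: clusters_def del: upt_Suc)
  have "C (Suc n) (Suc J) \<omega> = sum_list ?new"
    using C_step[of "Suc J" \<omega> n] assms
    by (simp add: interv_sum_list_conv_sum_set_nat atLeastLessThanSuc_atLeastAtMost del: upt_Suc)
  then have "clusters (Suc n) (Suc J) \<omega> = clusters (Suc n) J \<omega> @ [sum_list ?new]"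
    by (simp add: clusters_def)
  also have "\<dots> = block_sums (mergers n J \<omega> @ [M n (Suc J) \<omega> - M n J \<omega>])
      (clusters n (M n J \<omega>) \<omega> @ ?new)"
    by (subst block_sums_snoc) (simp_all add: Suc.IH sum_list_mergers[OF assms] length_clusters del: upt_Suc)
  finally show ?case
    by (simp add: old mergers_def)
qed

text \<open>
  Both lists are functions of finitely many coordinates of the two families assumed independent.
\<close>
lemma indep_mergers_clusters:
  "indep_var (count_space UNIV) (mergers n J) (count_space UNIV) (clusters n N)"
proof -
  let ?A = "Pi\<^sub>M ({n} \<times> UNIV) (\<lambda>_. count_space UNIV) :: (nat \<times> nat \<Rightarrow> nat) measure"
  let ?B = "Pi\<^sub>M ({..n} \<times> {1..}) (\<lambda>_. count_space UNIV) :: (nat \<times> nat \<Rightarrow> nat) measure"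
  let ?f = "\<lambda>x :: nat \<times> nat \<Rightarrow> nat. map (\<lambda>k. x (n, Suc k) - x (n, k)) [0..<J]"
  let ?g = "\<lambda>x :: nat \<times> nat \<Rightarrow> nat. map (\<lambda>i. x (n, i)) [1..<Suc N]"
  have "?f \<in> measurable ?A (count_space UNIV)"
  proof (rule measurable_map_countable)
    fix k
    have comp: "(\<lambda>x. x (n, i)) \<in> measurable ?A (count_space UNIV)" for i
      by (rule measurable_component_singleton) simp
    show "(\<lambda>x. x (n, Suc k) - x (n, k)) \<in> measurable ?A (count_space UNIV)"
      by (rule measurable_compose_countable[OF measurable_compose[OF comp] comp]) simp
  qed
  moreover have "?g \<in> measurable ?B (count_space UNIV)"
    by (rule measurable_map_countable, rule measurable_component_singleton) auto
  ultimately have "indep_var (count_space UNIV) (?f \<circ> (\<lambda>\<omega>. \<lambda>(m, k)\<in>{n} \<times> UNIV. M m k \<omega>))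
      (count_space UNIV) (?g \<circ> (\<lambda>\<omega>. \<lambda>(m, j)\<in>{..n} \<times> {1..}. C m j \<omega>))"
    by (rule indep_var_compose[OF indep_past])
  moreover have "?f \<circ> (\<lambda>\<omega>. \<lambda>(m, k)\<in>{n} \<times> UNIV. M m k \<omega>) = mergers n J"
    by (auto simp: mergers_def fun_eq_iff)
  moreover have "?g \<circ> (\<lambda>\<omega>. \<lambda>(m, j)\<in>{..n} \<times> {1..}. C m j \<omega>) = clusters n N"
    by (auto simp: clusters_def fun_eq_iff simp del: upt_Suc)
  ultimately show ?thesis by simp
qed

lemma measurable_mergers [measurable]: "mergers n J \<in> measurable P (count_space UNIV)"
  using indep_var_rv1[OF indep_mergers_clusters] .

lemma measurable_clusters [measurable]: "clusters n N \<in> measurable P (count_space UNIV)"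
  using indep_var_rv2[OF indep_mergers_clusters] .

lemma prob_mergers:
  "prob {\<omega> \<in> space P. mergers n J \<omega> = ds} = pmf (replicate_pmf J p) ds"
proof (cases "length ds = J \<and> J > 0")
  case True
  let ?D = "\<lambda>k \<omega>. M n (Suc k) \<omega> - M n k \<omega>"
  have [measurable]: "?D k \<in> measurable P (count_space UNIV)" for k
    using incr_indep[of n] by (auto simp: indep_vars_def)
  have law: "prob (?D k -` {ds ! k} \<inter> space P) = pmf p (ds ! k)" for k
    using arg_cong[OF incr_law[of n k], of "\<lambda>N. measure N {ds ! k}"]
    by (simp add: measure_distr measure_pmf_single)
  have "{\<omega> \<in> space P. mergers n J \<omega> = ds} = (\<Inter>k\<in>{..<J}. ?D k -` {ds ! k} \<inter> space P)"
    using True by (auto simp: mergers_def list_eq_iff_nth_eq)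
  also have "prob \<dots> = (\<Prod>k\<in>{..<J}. prob (?D k -` {ds ! k} \<inter> space P))"
    using True by (intro indep_varsD[OF incr_indep]) auto
  also have "\<dots> = prod_list (map (pmf p) ds)"
    using True by (simp add: law prod.list_conv_set_nth lessThan_atLeast0)
  finally show ?thesis
    using True by (simp add: pmf_replicate_pmf)
next
  case False
  then have "mergers n J \<omega> = ds \<longleftrightarrow> J = 0 \<and> ds = []" for \<omega>
    by (auto simp: mergers_def)
  then show ?thesis
    using False by (cases "J = 0 \<and> ds = []") (auto simp: pmf_replicate_pmf prob_space)
qed

text \<open>
  Given block lengths \<open>ds\<close>, the \<open>sum_list ds\<close> clusters that they consume still have their
  unconditional law, because the lengths are independent of the clusters.
\<close>
lemma distr_clusters_Suc:
  assumes law: "\<And>N. distr P (count_space UNIV) (clusters n N) = measure_pmf (replicate_pmf N q)"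
  shows "distr P (count_space UNIV) (clusters (Suc n) J)
       = measure_pmf (replicate_pmf J (bind_pmf p (\<lambda>m. iid_sum m q)))"
proof -
  let ?X = "\<lambda>ds \<omega>. block_sums ds (clusters n (sum_list ds) \<omega>)"
  let ?S = "\<lambda>ds. map_pmf (block_sums ds) (replicate_pmf (sum_list ds) q)"
  have "distr P (count_space UNIV) (clusters (Suc n) J)
      = distr P (count_space UNIV) (\<lambda>\<omega>. ?X (mergers n J \<omega>) \<omega>)"
    by (intro distr_cong refl) (simp add: clusters_Suc)
  also have "\<dots> = measure_pmf (bind_pmf (replicate_pmf J p) ?S)"
  proof (rule distr_mixture[where X = ?X])
    show "mergers n J \<in> measurable P (count_space UNIV)" by measurable
    show "?X ds \<in> measurable P (count_space UNIV)" for ds by measurable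
  next
    fix ds xs
    let ?E = "block_sums ds -` {xs}"
    have "{\<omega> \<in> space P. mergers n J \<omega> = ds \<and> ?X ds \<omega> = xs}
        = (\<lambda>\<omega>. (mergers n J \<omega>, clusters n (sum_list ds) \<omega>)) -` ({ds} \<times> ?E) \<inter> space P"
      by auto
    also have "prob \<dots> = prob (mergers n J -` {ds} \<inter> space P)
        * prob (clusters n (sum_list ds) -` ?E \<inter> space P)"
      by (rule indep_varD[OF indep_mergers_clusters]) auto
    also have "prob (mergers n J -` {ds} \<inter> space P) = pmf (replicate_pmf J p) ds"
      using prob_mergers[of n J ds] by (simp add: vimage_def Int_def conj_commute)
    also have "prob (clusters n (sum_list ds) -` ?E \<inter> space P) = pmf (?S ds) xs"
      using arg_cong[OF law[of "sum_list ds"], of "\<lambda>N. measure N ?E"]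
      by (simp add: measure_distr pmf_map)
    finally show "emeasure P {\<omega> \<in> space P. mergers n J \<omega> = ds \<and> ?X ds \<omega> = xs}
        = ennreal (pmf (replicate_pmf J p) ds * pmf (?S ds) xs)"
      by (simp add: emeasure_eq_measure)
  qed
  finally show ?thesis
    by (simp add: block_sums_replicate_pmf)
qed

primrec cluster_pmf :: "nat \<Rightarrow> nat pmf" where
  "cluster_pmf 0 = return_pmf 1"
| "cluster_pmf (Suc n) = bind_pmf p (\<lambda>m. iid_sum m (cluster_pmf n))"

lemma distr_clusters:
  "distr P (count_space UNIV) (clusters n N) = measure_pmf (replicate_pmf N (cluster_pmf n))"
proof (induction n arbitrary: N)
  case 0
  have "distr P (count_space UNIV) (clusters 0 N) = distr P (count_space UNIV) (\<lambda>_. replicate N 1)"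
    by (intro distr_cong refl) (auto simp: clusters_def C_init list_eq_iff_nth_eq simp del: upt_Suc)
  then show ?case
    by (simp add: replicate_pmf_return distr_const return_pmf.rep_eq)
next
  case (Suc n)
  show ?case
    using distr_clusters_Suc[OF Suc.IH] by simp
qed

lemma prob_cluster:
  assumes "i \<ge> 1"
  shows "prob {\<omega> \<in> space P. C n i \<omega> \<in> A} = measure_pmf.prob (cluster_pmf n) A"
proof -
  let ?E = "(\<lambda>xs. xs ! (i - 1)) -` A"
  have "{\<omega> \<in> space P. C n i \<omega> \<in> A} = clusters n i -` ?E \<inter> space P"
    using assms by (auto simp: clusters_def simp del: upt_Suc)
  also have "prob \<dots> = measure (distr P (count_space UNIV) (clusters n i)) ?E"
    by (simp add: measure_distr)
  also have "\<dots> = measure_pmf.prob (map_pmf (\<lambda>xs. xs ! (i - 1)) (replicate_pmf i (cluster_pmf n))) A"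
    by (simp add: distr_clusters)
  also have "\<dots> = measure_pmf.prob (cluster_pmf n) A"
    using assms by (simp add: map_nth_replicate_pmf)
  finally show ?thesis .
qed

lemma cluster_dist_eq: "cluster_dist P C n = pmf (cluster_pmf n)"
  using prob_cluster[of 1 n "{_}"] by (auto simp: cluster_dist_def measure_pmf_single fun_eq_iff)

lemma nonempty_prob_eq: "nonempty_prob P C n = measure_pmf.prob (cluster_pmf n) {0<..}"
  using prob_cluster[of 1 n "{0<..}"] by (simp add: nonempty_prob_def)

lemma nonempty_prob_pos: "critical p \<Longrightarrow> nonempty_prob P C n > 0"
  unfolding nonempty_prob_eq by (induction n) (simp_all add: prob_pos_bind_iid_sum)

end

section \<open>The rate equation for the coagulation process\<close>

theorem proposition2p3:
  fixes P :: "'w measure"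
    and p :: "nat pmf"
    and C M :: "nat \<Rightarrow> nat \<Rightarrow> 'w \<Rightarrow> nat"
    and \<nu> :: "nat \<Rightarrow> nat \<Rightarrow> real"
    and \<rho> :: "nat \<Rightarrow> real"
  assumes "discrete_coagulation P p C M"
    and "critical p"
  defines "\<nu> \<equiv> cluster_dist P C"
    and "\<rho> \<equiv> nonempty_prob P C"
  shows "\<forall>n. (\<forall>i\<ge>1. \<forall>j. measure P {\<omega> \<in> space P. C n i \<omega> = j} = \<nu> n j)
           \<and> (\<nu> n has_sum \<rho> n) {0<..}
           \<and> \<rho> n > 0
           \<and> (\<forall>k\<ge>2. rate_term p k (\<rho> n) summable_on {k..})
           \<and> (\<forall>j>0. (\<forall>k\<ge>2. coag_term k (\<rho> n) (\<nu> n) j summable_on ({1..k} \<rightarrow>\<^sub>E {0<..}))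
                 \<and> ((\<lambda>k. rate p k (\<rho> n) * coag k (\<rho> n) (\<nu> n) j)
                      has_sum (\<nu> (Suc n) j - \<nu> n j)) {2..})"
proof (intro allI conjI impI)
  interpret discrete_coagulation P p C M by fact
  fix n
  show pos: "\<rho> n > 0"
    unfolding \<rho>_def using assms(2) by (rule nonempty_prob_pos)
  have \<nu>: "\<nu> m = pmf (cluster_pmf m)" for m
    by (simp add: \<nu>_def cluster_dist_eq)
  have \<rho>: "\<rho> n = measure_pmf.prob (cluster_pmf n) {0<..}"
    by (simp add: \<rho>_def nonempty_prob_eq)
  show "measure P {\<omega> \<in> space P. C n i \<omega> = j} = \<nu> n j" if "i \<ge> 1" for i j
    using prob_cluster[OF that, of n "{j}"] by (simp add: \<nu> measure_pmf_single)
  have "((\<lambda>j. pmf (cluster_pmf n) j * indicator {0<..} j) has_sum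
      measure_pmf.expectation (cluster_pmf n) (indicator {0<..})) {0<..}"
  proof (rule has_sum_expectation_pmf)
    show "integrable (measure_pmf (cluster_pmf n)) (indicator {0<..} :: nat \<Rightarrow> real)"
      by (rule measure_pmf.integrable_const_bound[where B = 1]) auto
  qed (simp add: indicator_def split: if_splits)
  then show "(\<nu> n has_sum \<rho> n) {0<..}"
    using has_sum_cong[of "{0<..}" "\<lambda>j. pmf (cluster_pmf n) j * indicator {0<..} j" "\<nu> n"]
    by (simp add: \<nu> \<rho>)
  show "rate_term p k (\<rho> n) summable_on {k..}" for k
    by (rule has_sum_imp_summable, rule has_sum_rate_term) (simp add: \<rho>)
  fix j :: nat assume j: "j > 0"
  show "coag_term k (\<rho> n) (\<nu> n) j summable_on ({1..k} \<rightarrow>\<^sub>E {0<..})" for k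
    using coagulation_rate_equation(1)[OF assms(2) pos[unfolded \<rho>] j] by (simp add: \<nu> \<rho>)
  show "((\<lambda>k. rate p k (\<rho> n) * coag k (\<rho> n) (\<nu> n) j) has_sum (\<nu> (Suc n) j - \<nu> n j)) {2..}"
    using coagulation_rate_equation(2)[OF assms(2) pos[unfolded \<rho>] j] by (simp add: \<nu> \<rho>)
qed

end
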